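(* Under the assumptions (1)--(4) listed in the context, the temporal scheme described in the context (the bounds preserving Runge--Kutta scheme, with update $\mathbf u_i^{n+1}=\overline{\mathbf u}_i^{n+1}+\mathbf S_i$) is bounds preserving for all $\{\mathcal B_i\}_{i\in V}$. Here a temporal integration scheme is called bounds preserving if for any solution $\mathbf u_i^n\in\mathcal B_i$, there exists a sufficiently small time step $\Delta t>0$ such that $\mathbf u_i^{n+1}\in\mathcal B_i$ for all $i\in V$, irrespective of the spatial discretization $\mathbf L(\mathbf u_i,t^n)$.
   Context: **Semidiscretization.** Consider a hyperbolic conservation law $\partial_t\mathbf u+\nabla\cdot\mathbf F(\mathbf u)=0$ on $\Omega\subset\mathbb R^d$, with solution $\mathbf u\in\mathbb R^m$ and flux $\mathbf F(\mathbf u)\in(\mathbb R^m)^d$. Let $\mathbf U_h(t)=\sum_{i\in V}\mathbf u_i(t)\phi_i(\mathbf x)$ be a discrete approximation of $\mathbf u$ via a basis $\{\phi_i\}_{i\in V}$ of a finite-dimensional vector space. The explicit semidiscretization is $$\partial_t\mathbf u_i\approx-\sum_{j\in\mathcal I(i)}\mathbf c_{ij}\cdot\mathbf F(\mathbf u_j)=\mathbf L(\mathbf u_i,t),\qquad i\in V,$$ where $\mathcal I(i)\subseteq V$ is the stencil at $i$ and $\mathbf c_{ij}$ is an $\mathbb R^d$-valued matrix dependent on the spatial discretization. The $m_i$ are positive quantities dependent on the spatial discretization such that $\sum_{i\in V}m_i\mathbf u_i^n\approx\int_\Omega\mathbf U_h(t^n)$. **Base Runge--Kutta (RK) method.** An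 explicit $s$-stage method with Butcher tableau $(A,b,c)$, $A\in\mathbb R^{s\times s}$ strictly lower triangular, $b,c\in\mathbb R^s$. Here $\mathbf u_i^n\approx\mathbf u_i(t^n)$ and $t^{n+1}=t^n+\Delta t$ for a time step $\Delta t>0$, $n\in\mathbb N$. **The scheme.** For the solution $\{\mathbf u_i^n\}_{i\in V}$ one has admissible sets $\mathcal B_i\subseteq\mathbb R^m$ (possibly different for each $i\in V$) and bijective mappings $\mathbf G_i:\mathcal B_i\to\mathbb R^m$ with Jacobian $\mathbf G_i'$. Put $\mathbf w_i^n=\mathbf G_i(\mathbf u_i^n)$ and $$\overline{\mathbf u}_{ij}^*=\mathbf G_i^{-1}\Big[\mathbf w_i^n+\Delta t\sum_{k=1}^sA_{jk}\mathbf G_i'(\overline{\mathbf u}_{ik}^* )\overline{\mathbf L}_{ik}\Big],\quad j\in\{1,\dots,s\},$$ $$\overline{\mathbf u}_i^{n+1}=\mathbf G_i^{-1}(\mathbf w_i^{n+1})=\mathbf G_i^{-1}\Big[\mathbf w_i^n+\Delta t\sum_{k=1}^sb_k\mathbf G_i'(\overline{\mathbf u}_{ik}^* )\overline{\mathbf L}_{ik}\Big],$$ with $\overline{\mathbf L}_{ik}=\mathbf L(\overline{\mathbf u}_{ik}^*,t^n+c_k\Delta t)$; $\overline{\mathbf u}_i^{n+1}$ is called the intermediate temporal update. The global mass defect is $\overline{\mathbf S}=\sum_{i\in V}m_i(\mathbf u_i^n-\overline{\mathbf u}_i^{n+1})$, and $\mathbf n=\overline{\mathbf S}/\|\overline{\mathbf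 S}\|_2$. For a set $X\subset\mathbb R^m$, the Euclidean distance from $\mathbf u\in X$ to the boundary $\partial X$ along a unit vector $\mathbf n$ is defined as $$D_X(\mathbf u,\mathbf n)=\underset{\gamma\ge0}{\mathrm{arg\,min}}\Big(\inf_{\mathbf x\in\partial X}\|\mathbf u+\gamma\mathbf n-\mathbf x\|_2\Big).$$ Set $\gamma_i^*=D_{\mathcal B_i}(\overline{\mathbf u}_i^{n+1},\mathbf n)$, $\gamma_i=\gamma_i^*\|\overline{\mathbf S}\|_2\big/\sum_{j\in V}m_j\gamma_j^*$, $\mathbf S_i=\gamma_i\mathbf n$. The temporal update is $\mathbf u_i^{n+1}=\overline{\mathbf u}_i^{n+1}+\mathbf S_i$. **Assumptions.** (1) There exists an open, quasiconvex, non-empty set $\mathcal B_i\subseteq\mathbb R^m$ for all $i\in V$ such that $\mathbf u_i^n\in\mathcal B_i$ for all $i\in V$. (2) There exists a bijective $C^\infty(\mathcal B_i)$ mapping $\mathbf G_i:\mathcal B_i\to\mathbb R^m$ such that for all $i\in V$ the intermediate temporal update results in $\overline{\mathbf u}_i^{n+1}\in\mathcal B_i$ if $\mathbf u_i^n\in\mathcal B_i$. (3) Periodic boundary conditions are enforced (i.e., $\Omega$ is a $d$-torus). (4) The underlying spatial discretization $\mathbf L(\mathbf u,t)$ preserves linear invariants, i.e., $\sum_{i\in V}m_iR(\mathbf u_i^n,\mathbf u_i^{n'})=0$ for any $n,n'$, where $R(\mathbf u,\mathbf u')=Q(\mathbf u)-Q(\mathbf u')=Q(\mathbf u-\mathbf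 u')$ is the residual of a linear invariant $Q(\mathbf u)=\mathbf c\cdot\mathbf u$, $\mathbf c\in\mathbb R^m\setminus\{\mathbf 0\}$. *)

theory Defs
  imports "HOL-Analysis.Analysis"
begin

section \<open>Quasiconvex sets, smooth maps, hyperbolic fluxes\<close>

definition path_length :: "(real \<Rightarrow> 'a::metric_space) \<Rightarrow> ereal" where
  "path_length g =
     (SUP (N, t) \<in> {(N :: nat, t :: nat \<Rightarrow> real). mono_on {..N} t \<and> t ` {..N} \<subseteq> {0..1}}.
        ereal (\<Sum>k<N. dist (g (t k)) (g (t (Suc k)))))"

text \<open>Quasiconvexity in the sense of metric geometry: the intrinsic length metric of the set is
  bounded by a constant multiple of the Euclidean one.\<close>

definition quasiconvex :: "'a::real_normed_vector set \<Rightarrow> bool" where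
  "quasiconvex X \<longleftrightarrow>
     (\<exists>C\<ge>1. \<forall>x\<in>X. \<forall>y\<in>X. \<exists>g. path g \<and> path_image g \<subseteq> X \<and> pathstart g = x \<and> pathfinish g = y \<and>
        path_length g \<le> ereal (C * dist x y))"

text \<open>Only used for open \<open>S\<close>, where \<open>at x\<close> and \<open>at x within S\<close> agree.\<close>

primrec Ck_on :: "nat \<Rightarrow> ('a::real_normed_vector \<Rightarrow> 'b::real_normed_vector) \<Rightarrow> 'a set \<Rightarrow> bool" where
  "Ck_on 0 f S \<longleftrightarrow> continuous_on S f"
| "Ck_on (Suc k) f S \<longleftrightarrow>
     f differentiable_on S \<and> (\<forall>v. Ck_on k (\<lambda>x. frechet_derivative f (at x) v) S)"

definition Cinf_on :: "('a::real_normed_vector \<Rightarrow> 'b::real_normed_vector) \<Rightarrow> 'a set \<Rightarrow> bool" where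
  "Cinf_on f S \<longleftrightarrow> (\<forall>k. Ck_on k f S)"

definition real_diagonalizable :: "real^'n^'n \<Rightarrow> bool" where
  "real_diagonalizable M \<longleftrightarrow>
     (\<exists>(P :: real^'n^'n) (D :: real^'n^'n). invertible P \<and> (\<forall>a b. a \<noteq> b \<longrightarrow> D $ a $ b = 0) \<and> M = P ** D ** matrix_inv P)"

text \<open>A flux \<open>F\<close> has the component \<open>F u $ k\<close> (a vector of states) in the spatial direction \<open>k\<close>.
  Hyperbolicity is only asked for on a set \<open>X\<close> of states, since physical fluxes are often
  undefined outside the admissible states.\<close>

definition hyperbolic_on :: "(real^'m) set \<Rightarrow> (real^'m \<Rightarrow> real^'m^'d) \<Rightarrow> bool" where
  "hyperbolic_on X F \<longleftrightarrow>
     (\<forall>u\<in>X. F differentiable (at u) \<and>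
        (\<forall>\<nu> :: real^'d. norm \<nu> = 1 \<longrightarrow>
           real_diagonalizable (jacobian (\<lambda>w. \<Sum>k\<in>UNIV. (\<nu> $ k) *\<^sub>R (F w $ k)) (at u))))"


section \<open>Spatial semidiscretization\<close>

text \<open>The torus with periods \<open>P\<close> is the quotient of \<open>d\<close>-space by the lattice spanned by the vectors
  \<open>axis k (P $ k)\<close>; functions on it are the periodic functions.\<close>

definition on_torus :: "real^'d \<Rightarrow> (real^'d \<Rightarrow> real) \<Rightarrow> bool" where
  "on_torus P f \<longleftrightarrow> (\<forall>k x. f (x + axis k (P $ k)) = f x)"

definition independent_family :: "'v set \<Rightarrow> ('v \<Rightarrow> real^'d \<Rightarrow> real) \<Rightarrow> bool" where
  "independent_family V \<phi> \<longleftrightarrow>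
     (\<forall>a. (\<forall>x. (\<Sum>i\<in>V. a i * \<phi> i x) = 0) \<longrightarrow> (\<forall>i\<in>V. a i = 0))"

text \<open>The right-hand side at node \<open>i\<close>, for stencils \<open>St\<close> and coefficients \<open>cc\<close>. It depends on the
  whole grid function \<open>u\<close>; the time argument is the formal one of the semidiscretization, which is
  autonomous.\<close>

definition semidisc ::
  "('v \<Rightarrow> 'v set) \<Rightarrow> ('v \<Rightarrow> 'v \<Rightarrow> real^'d) \<Rightarrow> (real^'m \<Rightarrow> real^'m^'d) \<Rightarrow>
   ('v \<Rightarrow> real^'m) \<Rightarrow> real \<Rightarrow> 'v \<Rightarrow> real^'m" where
  "semidisc St cc F u t i = - (\<Sum>j\<in>St i. \<Sum>k\<in>UNIV. (cc i j $ k) *\<^sub>R (F (u j) $ k))"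

definition semidisc_solution ::
  "'v set \<Rightarrow> ('v \<Rightarrow> (real^'m) set) \<Rightarrow> (('v \<Rightarrow> real^'m) \<Rightarrow> real \<Rightarrow> 'v \<Rightarrow> real^'m) \<Rightarrow>
   real \<Rightarrow> real \<Rightarrow> (real \<Rightarrow> 'v \<Rightarrow> real^'m) \<Rightarrow> bool" where
  "semidisc_solution V B L a b u \<longleftrightarrow>
     (\<forall>t\<in>{a..b}. \<forall>i\<in>V. u t i \<in> B i \<and>
        ((\<lambda>\<tau>. u \<tau> i) has_vector_derivative L (u t) t i) (at t within {a..b}))"

definition linear_invariant :: "real^'m \<Rightarrow> real^'m \<Rightarrow> real" where
  "linear_invariant q u = q \<bullet> u"

definition residual :: "(real^'m \<Rightarrow> real) \<Rightarrow> real^'m \<Rightarrow> real^'m \<Rightarrow> real" where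
  "residual Q u u' = Q u - Q u'"

text \<open>A property of the spatial discretization \<open>L\<close> alone: the two time levels are times of an
  arbitrary solution of the semidiscrete system, not of a fully discrete one.\<close>

definition preserves_linear_invariants ::
  "'v set \<Rightarrow> ('v \<Rightarrow> (real^'m) set) \<Rightarrow> ('v \<Rightarrow> real) \<Rightarrow>
   (('v \<Rightarrow> real^'m) \<Rightarrow> real \<Rightarrow> 'v \<Rightarrow> real^'m) \<Rightarrow> bool" where
  "preserves_linear_invariants V B m L \<longleftrightarrow>
     (\<forall>a b u. semidisc_solution V B L a b u \<longrightarrow>
        (\<forall>q. q \<noteq> 0 \<longrightarrow> (\<forall>t\<in>{a..b}. \<forall>t'\<in>{a..b}.
           (\<Sum>i\<in>V. m i * residual (linear_invariant q) (u t i) (u t' i)) = 0)))"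


section \<open>The bounds preserving Runge-Kutta scheme\<close>

text \<open>Stages and nodes are numbered from 1 to \<open>rk_s\<close>; other entries are never used.\<close>

record butcher =
  rk_s :: nat
  rk_A :: "nat \<Rightarrow> nat \<Rightarrow> real"
  rk_b :: "nat \<Rightarrow> real"
  rk_c :: "nat \<Rightarrow> real"

definition explicit_rk :: "butcher \<Rightarrow> bool" where
  "explicit_rk T \<longleftrightarrow> (\<forall>j\<in>{1..rk_s T}. \<forall>k\<in>{1..rk_s T}. j \<le> k \<longrightarrow> rk_A T j k = 0)"

text \<open>In the following, \<open>U k i\<close> is the stage value number \<open>k\<close> at node \<open>i\<close>.\<close>

definition rk_slope ::
  "('v \<Rightarrow> real^'m \<Rightarrow> real^'m) \<Rightarrow> (('v \<Rightarrow> real^'m) \<Rightarrow> real \<Rightarrow> 'v \<Rightarrow> real^'m) \<Rightarrow> butcher \<Rightarrow>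
   real \<Rightarrow> real \<Rightarrow> (nat \<Rightarrow> 'v \<Rightarrow> real^'m) \<Rightarrow> nat \<Rightarrow> 'v \<Rightarrow> real^'m" where
  "rk_slope G L T tn dt U k i =
     jacobian (G i) (at (U k i)) *v L (U k) (tn + rk_c T k * dt) i"

definition rk_stages ::
  "'v set \<Rightarrow> ('v \<Rightarrow> (real^'m) set) \<Rightarrow> ('v \<Rightarrow> real^'m \<Rightarrow> real^'m) \<Rightarrow>
   (('v \<Rightarrow> real^'m) \<Rightarrow> real \<Rightarrow> 'v \<Rightarrow> real^'m) \<Rightarrow> butcher \<Rightarrow>
   real \<Rightarrow> real \<Rightarrow> ('v \<Rightarrow> real^'m) \<Rightarrow> (nat \<Rightarrow> 'v \<Rightarrow> real^'m) \<Rightarrow> bool" where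
  "rk_stages V B G L T tn dt u U \<longleftrightarrow>
     (\<forall>i\<in>V. \<forall>j\<in>{1..rk_s T}.
        U j i = inv_into (B i) (G i)
          (G i (u i) + dt *\<^sub>R (\<Sum>k=1..rk_s T. rk_A T j k *\<^sub>R rk_slope G L T tn dt U k i)))"

definition intermediate_update ::
  "('v \<Rightarrow> (real^'m) set) \<Rightarrow> ('v \<Rightarrow> real^'m \<Rightarrow> real^'m) \<Rightarrow>
   (('v \<Rightarrow> real^'m) \<Rightarrow> real \<Rightarrow> 'v \<Rightarrow> real^'m) \<Rightarrow> butcher \<Rightarrow>
   real \<Rightarrow> real \<Rightarrow> ('v \<Rightarrow> real^'m) \<Rightarrow> (nat \<Rightarrow> 'v \<Rightarrow> real^'m) \<Rightarrow> 'v \<Rightarrow> real^'m" where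
  "intermediate_update B G L T tn dt u U i =
     inv_into (B i) (G i)
       (G i (u i) + dt *\<^sub>R (\<Sum>k=1..rk_s T. rk_b T k *\<^sub>R rk_slope G L T tn dt U k i))"

definition mass_defect ::
  "'v set \<Rightarrow> ('v \<Rightarrow> real) \<Rightarrow> ('v \<Rightarrow> real^'m) \<Rightarrow> ('v \<Rightarrow> real^'m) \<Rightarrow> real^'m" where
  "mass_defect V m u ub = (\<Sum>i\<in>V. m i *\<^sub>R (u i - ub i))"

text \<open>The distance to the boundary along \<open>n\<close> is a minimizer \<open>\<gamma>\<close> over the nonnegative reals, so it
  need not be unique (the line may hit the boundary several times; every choice is allowed), and it
  need not exist (the boundary may only be approached asymptotically; then any nonnegative value is
  allowed). If the boundary is empty, \<^const>\<open>infdist\<close> is constantly 0, so every \<open>\<gamma> \<ge> 0\<close> is a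
  minimizer, as it is with the convention that the infimum over the empty set is infinite.\<close>

definition boundary_gap :: "(real^'m) set \<Rightarrow> real^'m \<Rightarrow> real^'m \<Rightarrow> real \<Rightarrow> real" where
  "boundary_gap X u n \<gamma> = infdist (u + \<gamma> *\<^sub>R n) (frontier X)"

definition is_boundary_distance :: "(real^'m) set \<Rightarrow> real^'m \<Rightarrow> real^'m \<Rightarrow> real \<Rightarrow> bool" where
  "is_boundary_distance X u n \<gamma> \<longleftrightarrow>
     0 \<le> \<gamma> \<and>
     ((\<exists>\<gamma>'. is_arg_min (boundary_gap X u n) (\<lambda>\<gamma>. 0 \<le> \<gamma>) \<gamma>') \<longrightarrow>
        is_arg_min (boundary_gap X u n) (\<lambda>\<gamma>. 0 \<le> \<gamma>) \<gamma>)"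

text \<open>\<open>v\<close> is a possible outcome of one time step of size \<open>dt\<close> from \<open>u\<close> at time \<open>tn\<close>. Where the
  formulas divide by zero, \<open>x / 0 = 0\<close> makes the correction vanish: this happens if the mass defect
  is zero (nothing to correct, \<open>n\<close> would be undefined), or if all \<open>\<gamma>s j\<close> are zero.\<close>

definition bprk_step ::
  "'v set \<Rightarrow> ('v \<Rightarrow> (real^'m) set) \<Rightarrow> ('v \<Rightarrow> real^'m \<Rightarrow> real^'m) \<Rightarrow> ('v \<Rightarrow> real) \<Rightarrow>
   (('v \<Rightarrow> real^'m) \<Rightarrow> real \<Rightarrow> 'v \<Rightarrow> real^'m) \<Rightarrow> butcher \<Rightarrow>
   real \<Rightarrow> real \<Rightarrow> ('v \<Rightarrow> real^'m) \<Rightarrow> ('v \<Rightarrow> real^'m) \<Rightarrow> bool" where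
  "bprk_step V B G m L T tn dt u v \<longleftrightarrow>
     (\<exists>U \<gamma>s. rk_stages V B G L T tn dt u U \<and>
        (let ub = intermediate_update B G L T tn dt u U;
             S = mass_defect V m u ub;
             n = S /\<^sub>R norm S
         in (\<forall>i\<in>V. is_boundary_distance (B i) (ub i) n (\<gamma>s i)) \<and>
            (\<forall>i\<in>V. v i = ub i + (\<gamma>s i * norm S / (\<Sum>j\<in>V. m j * \<gamma>s j)) *\<^sub>R n)))"

text \<open>\<open>step tn dt u v\<close> is a one-step scheme given as a relation. For all sufficiently small time
  steps the scheme has an outcome, and all its outcomes are admissible. The bound \<open>\<delta>\<close> may depend on
  \<open>u\<close> and on the spatial discretization.\<close>

definition bounds_preserving ::
  "'v set \<Rightarrow> ('v \<Rightarrow> (real^'m) set) \<Rightarrow>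
   (real \<Rightarrow> real \<Rightarrow> ('v \<Rightarrow> real^'m) \<Rightarrow> ('v \<Rightarrow> real^'m) \<Rightarrow> bool) \<Rightarrow> bool" where
  "bounds_preserving V B step \<longleftrightarrow>
     (\<forall>tn u. (\<forall>i\<in>V. u i \<in> B i) \<longrightarrow>
        (\<exists>\<delta>>0. \<forall>dt. 0 < dt \<and> dt \<le> \<delta> \<longrightarrow>
           (\<exists>v. step tn dt u v) \<and>
           (\<forall>v. step tn dt u v \<longrightarrow> (\<forall>i\<in>V. v i \<in> B i))))"

end

theory Submission
  imports Defs
begin

text \<open>Since \<open>\<Sum>j\<in>V. m j * \<gamma>s j \<ge> m i * \<gamma>s i\<close>, the correction at node \<open>i\<close> has norm at most
  \<open>norm S / m i\<close>, whatever the boundary distances are. As \<open>dt\<close> tends to 0, the stages and the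
  intermediate update converge to \<open>u\<close>, because the inverse of \<open>G i\<close> is continuous by invariance of
  domain; so the mass defect \<open>S\<close> and with it the correction tend to 0. The outcome therefore
  converges to \<open>u i\<close>, which lies in the open set \<open>B i\<close>.\<close>

section \<open>Continuity of the inverse mappings and of the slopes\<close>

lemma continuous_on_inv_into_homeo:
  fixes g :: "'a::euclidean_space \<Rightarrow> 'a"
  assumes "open S" and "continuous_on S g" and "bij_betw g S UNIV"
  shows "continuous_on UNIV (inv_into S g)"
proof -
  obtain h where h: "homeomorphism S UNIV g h"
    using invariance_of_domain_homeomorphism[of S g] assms
    by (metis bij_betw_def order_refl)
  have "inv_into S g y = h y" for y
    using h assms(3) by (metis UNIV_I bij_betw_def bij_betw_inv_into_left homeomorphism_def imageI)
  then have "inv_into S g = h" by auto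
  with h show ?thesis by (simp add: homeomorphism_cont2)
qed

text \<open>First-order smoothness makes every directional derivative of \<open>g\<close> continuous
  on \<open>S\<close>. The entries of the Jacobian are components of such derivatives along axis
  vectors, so the product converges entrywise.\<close>

lemma tendsto_jacobian_mult:
  fixes g :: "real^'m \<Rightarrow> real^'n"
  assumes "open S" and "Cinf_on g S" and "x \<in> S"
    and "(X \<longlongrightarrow> x) net" and "(Y \<longlongrightarrow> y) net"
  shows "((\<lambda>t. jacobian g (at (X t)) *v Y t) \<longlongrightarrow> jacobian g (at x) *v y) net"
proof -
  have "Ck_on (Suc 0) g S" using assms(2) by (simp add: Cinf_on_def del: Ck_on.simps)
  then have "isCont (\<lambda>z. frechet_derivative g (at z) v) x" for v
    using assms(1,3) by (simp add: continuous_on_eq_continuous_at)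
  then have "((\<lambda>t. frechet_derivative g (at (X t)) v) \<longlongrightarrow> frechet_derivative g (at x) v) net" for v
    using assms(4) isCont_tendsto_compose by blast
  with assms(5) show ?thesis
    unfolding jacobian_def matrix_def matrix_vector_mult_def
    by (intro tendsto_intros) (auto intro!: tendsto_intros)
qed

lemma tendsto_semidisc:
  fixes F :: "real^'m \<Rightarrow> real^'m^'d"
  assumes "\<And>j. j \<in> St i \<Longrightarrow> isCont F (u j)"
    and "\<And>j. j \<in> St i \<Longrightarrow> ((\<lambda>t. U t j) \<longlongrightarrow> u j) net"
  shows "((\<lambda>t. semidisc St cc F (U t) (\<tau> t) i) \<longlongrightarrow> semidisc St cc F u s i) net"
  unfolding semidisc_def
  using assms by (intro tendsto_intros) (auto intro: isCont_tendsto_compose)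

lemma hyperbolic_on_isCont: "hyperbolic_on X F \<Longrightarrow> u \<in> X \<Longrightarrow> isCont F u"
  by (simp add: hyperbolic_on_def differentiable_imp_continuous_within)

section \<open>Existence of stages and outcomes\<close>

text \<open>Lets a further stage be appended without disturbing earlier slopes: slope
  \<open>k\<close> reads only stage \<open>k\<close>, at nodes that the stencil keeps inside
  \<open>V\<close>.\<close>

lemma rk_slope_semidisc_cong:
  assumes "\<And>j. j \<in> V \<Longrightarrow> U k j = U' k j" and "i \<in> V" and "St i \<subseteq> V"
  shows "rk_slope G (semidisc St cc F) T tn dt U k i = rk_slope G (semidisc St cc F) T tn dt U' k i"
proof -
  have "U k j = U' k j" if "j \<in> St i" for j using assms that by blast
  then show ?thesis using assms by (simp add: rk_slope_def semidisc_def)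
qed

lemma explicit_rk_stages_exist:
  assumes "explicit_rk T" and St: "\<And>i. i \<in> V \<Longrightarrow> St i \<subseteq> V"
  shows "\<exists>U. rk_stages V B G (semidisc St cc F) T tn dt u U"
proof -
  define E where "E U j i = inv_into (B i) (G i) (G i (u i) +
      dt *\<^sub>R (\<Sum>k=1..rk_s T. rk_A T j k *\<^sub>R rk_slope G (semidisc St cc F) T tn dt U k i))" for U j i
  \<comment> \<open>The stage equations are solved one after the other; the invariant leaves stages
    beyond \<open>n\<close> arbitrary, although the sum in \<open>E\<close> runs over all of
    them.\<close>
  have "n \<le> rk_s T \<Longrightarrow> \<exists>U. \<forall>i\<in>V. \<forall>j\<in>{1..n}. U j i = E U j i" for n
  proof (induction n)
    case (Suc n)
    then obtain U where U: "\<forall>i\<in>V. \<forall>j\<in>{1..n}. U j i = E U j i" by auto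
    define U' where "U' = U(Suc n := E U (Suc n))"
    \<comment> \<open>Overwriting stage \<open>Suc n\<close> is harmless: terms with
      \<open>k < j\<close> do not see it, and terms with \<open>k \<ge> j\<close> have coefficient 0
      by explicitness.\<close>
    have "E U' j i = E U j i" if i: "i \<in> V" and j: "j \<in> {1..Suc n}" for i j
    proof -
      have "rk_A T j k *\<^sub>R rk_slope G (semidisc St cc F) T tn dt U' k i
          = rk_A T j k *\<^sub>R rk_slope G (semidisc St cc F) T tn dt U k i" if "k \<in> {1..rk_s T}" for k
      proof (cases "k < j")
        case True
        then have "U' k = U k" using j by (simp add: U'_def)
        then show ?thesis using rk_slope_semidisc_cong[of V U' k U i St] i St by metis
      next
        case False
        then show ?thesis using assms(1) that j Suc.prems by (simp add: explicit_rk_def)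
      qed
      then show ?thesis by (simp only: E_def cong: sum.cong)
    qed
    then have "\<forall>i\<in>V. \<forall>j\<in>{1..Suc n}. U' j i = E U' j i"
      using U by (auto simp: U'_def le_Suc_eq)
    then show ?case by blast
  qed simp
  then show ?thesis unfolding rk_stages_def E_def by blast
qed

text \<open>Take a minimizer if there is one; otherwise 0 will do.\<close>

lemma is_boundary_distance_exists: "\<exists>\<gamma>. is_boundary_distance X u n \<gamma>"
  unfolding is_boundary_distance_def is_arg_min_def by (metis order_refl)

lemma bprk_step_exists:
  assumes "rk_stages V B G L T tn dt u U"
  shows "\<exists>v. bprk_step V B G m L T tn dt u v"
proof -
  define ub where "ub = intermediate_update B G L T tn dt u U"
  define S where "S = mass_defect V m u ub"
  define n where "n = S /\<^sub>R norm S"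
  obtain \<gamma>s where "\<And>i. is_boundary_distance (B i) (ub i) n (\<gamma>s i)"
    using choice[of "\<lambda>i. is_boundary_distance (B i) (ub i) n"] is_boundary_distance_exists by blast
  then show ?thesis
    using assms unfolding bprk_step_def Let_def ub_def S_def n_def by fast
qed

section \<open>Size of the correction\<close>

lemma norm_correction_le:
  fixes S :: "'a::real_normed_vector"
  assumes "finite V" and "i \<in> V" and "\<And>j. j \<in> V \<Longrightarrow> 0 < m j" and "\<And>j. j \<in> V \<Longrightarrow> 0 \<le> \<gamma> j"
  shows "norm ((\<gamma> i * norm S / (\<Sum>j\<in>V. m j * \<gamma> j)) *\<^sub>R (S /\<^sub>R norm S)) \<le> norm S / m i"
proof -
  define s where "s = (\<Sum>j\<in>V. m j * \<gamma> j)"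
  have le: "m i * \<gamma> i \<le> s"
    unfolding s_def using assms by (intro member_le_sum) (auto simp: less_imp_le)
  have pos: "0 < m i" "0 \<le> \<gamma> i" using assms by auto
  then have "0 \<le> s" using le by (meson mult_nonneg_nonneg less_imp_le order_trans)
  \<comment> \<open>If \<open>s = 0\<close>, the quotient is 0 by convention and the bound is
    trivial.\<close>
  have "\<gamma> i / s \<le> 1 / m i"
    using le pos \<open>0 \<le> s\<close> by (cases "s = 0") (auto simp: field_simps)
  then have "norm S * (\<gamma> i / s) \<le> norm S * (1 / m i)" by (intro mult_left_mono) auto
  then show ?thesis
    using pos \<open>0 \<le> s\<close> unfolding s_def[symmetric] by (cases "S = 0") (simp_all add: field_simps)
qed

text \<open>Removes the boundary distances from the argument: the same bound holds for every choice
  of them.\<close>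

lemma bprk_step_dist_le:
  assumes "bprk_step V B G m L T tn dt u v"
    and "finite V" and "\<And>j. j \<in> V \<Longrightarrow> 0 < m j"
  obtains U where "rk_stages V B G L T tn dt u U"
    and "\<And>i. i \<in> V \<Longrightarrow> dist (v i) (intermediate_update B G L T tn dt u U i)
           \<le> norm (mass_defect V m u (intermediate_update B G L T tn dt u U)) / m i"
proof -
  obtain U \<gamma> where U: "rk_stages V B G L T tn dt u U" and
    \<gamma>: "\<And>i. i \<in> V \<Longrightarrow> 0 \<le> \<gamma> i" and
    v: "\<And>i. i \<in> V \<Longrightarrow> v i = intermediate_update B G L T tn dt u U i +
       (\<gamma> i * norm (mass_defect V m u (intermediate_update B G L T tn dt u U)) / (\<Sum>j\<in>V. m j * \<gamma> j)) *\<^sub>R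
       (mass_defect V m u (intermediate_update B G L T tn dt u U) /\<^sub>R
        norm (mass_defect V m u (intermediate_update B G L T tn dt u U)))"
    using assms(1) unfolding bprk_step_def Let_def is_boundary_distance_def by blast
  show thesis
  proof (rule that[OF U])
    fix i assume "i \<in> V"
    show "dist (v i) (intermediate_update B G L T tn dt u U i)
           \<le> norm (mass_defect V m u (intermediate_update B G L T tn dt u U)) / m i"
      unfolding v[OF \<open>i \<in> V\<close>] dist_norm add_diff_cancel_left'
      by (rule norm_correction_le) (use assms(2,3) \<gamma> \<open>i \<in> V\<close> in auto)
  qed
qed

section \<open>Limits for vanishing time step\<close>

text \<open>The common shape of all stages and of the intermediate update, with \<open>Z dt\<close>
  a weighted sum of slopes. Since \<open>Z\<close> converges, the factor \<open>dt\<close> removes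
  it in the limit.\<close>

lemma inv_into_perturbation_tendsto:
  fixes G :: "real^'m \<Rightarrow> real^'m"
  assumes "open S" and "Cinf_on G S" and "bij_betw G S UNIV" and "x \<in> S"
    and "(Z \<longlongrightarrow> z) (at_right 0)"
  shows "((\<lambda>dt. inv_into S G (G x + dt *\<^sub>R Z dt)) \<longlongrightarrow> x) (at_right 0)"
proof -
  have "continuous_on S G" using assms(2) by (metis Ck_on.simps(1) Cinf_on_def)
  then have "isCont (inv_into S G) (G x)"
    using assms(1,3) continuous_on_inv_into_homeo by (metis UNIV_I continuous_on_eq_continuous_at open_UNIV)
  moreover have "((\<lambda>dt. G x + dt *\<^sub>R Z dt) \<longlongrightarrow> G x + 0 *\<^sub>R z) (at_right 0)"
    by (intro tendsto_intros assms)
  then have "((\<lambda>dt. G x + dt *\<^sub>R Z dt) \<longlongrightarrow> G x) (at_right 0)"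
    by simp
  ultimately have "((\<lambda>dt. inv_into S G (G x + dt *\<^sub>R Z dt)) \<longlongrightarrow> inv_into S G (G x)) (at_right 0)"
    by (rule isCont_tendsto_compose)
  moreover have "inv_into S G (G x) = x"
    using assms(3,4) bij_betw_inv_into_left by metis
  ultimately show ?thesis by simp
qed

lemma intermediate_update_tendsto:
  fixes F :: "real^'m \<Rightarrow> real^'m^'d" and G :: "'v \<Rightarrow> real^'m \<Rightarrow> real^'m"
  assumes "explicit_rk T" and St: "\<And>i. i \<in> V \<Longrightarrow> St i \<subseteq> V"
    and cont: "\<And>i. i \<in> V \<Longrightarrow> isCont F (u i)"
    and B: "\<And>i. i \<in> V \<Longrightarrow> open (B i)"
    and G: "\<And>i. i \<in> V \<Longrightarrow> bij_betw (G i) (B i) UNIV \<and> Cinf_on (G i) (B i)"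
    and u: "\<And>i. i \<in> V \<Longrightarrow> u i \<in> B i"
    and U: "\<And>dt. dt > 0 \<Longrightarrow> rk_stages V B G (semidisc St cc F) T tn dt u (U dt)"
    and "i \<in> V"
  shows "((\<lambda>dt. intermediate_update B G (semidisc St cc F) T tn dt u (U dt) i) \<longlongrightarrow> u i) (at_right 0)"
proof -
  let ?L = "semidisc St cc F"
  \<comment> \<open>Convergence of stage \<open>k\<close> is assumed at all nodes, because the slope
    at \<open>i\<close> reads the whole stencil. For the same reason the induction below generalizes
    over \<open>i\<close>.\<close>
  have slope: "((\<lambda>dt. rk_slope G ?L T tn dt (U dt) k i) \<longlongrightarrow>
      jacobian (G i) (at (u i)) *v ?L u tn i) (at_right 0)"
    if "\<And>i. i \<in> V \<Longrightarrow> ((\<lambda>dt. U dt k i) \<longlongrightarrow> u i) (at_right 0)" and "i \<in> V" for k i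
    unfolding rk_slope_def
    using that St[OF that(2)] B G u cont
    by (intro tendsto_jacobian_mult[of "B i"] tendsto_semidisc) auto
  have stages: "((\<lambda>dt. U dt j i) \<longlongrightarrow> u i) (at_right 0)" if "j \<in> {1..rk_s T}" "i \<in> V" for i j
    using that
  proof (induction j arbitrary: i rule: less_induct)
    case (less j)
    define Z where "Z dt = (\<Sum>k=1..rk_s T. rk_A T j k *\<^sub>R rk_slope G ?L T tn dt (U dt) k i)" for dt
    have "((\<lambda>dt. rk_A T j k *\<^sub>R rk_slope G ?L T tn dt (U dt) k i) \<longlongrightarrow>
        rk_A T j k *\<^sub>R (jacobian (G i) (at (u i)) *v ?L u tn i)) (at_right 0)"
      if "k \<in> {1..rk_s T}" for k
    \<comment> \<open>For \<open>k \<ge> j\<close> the induction hypothesis gives no limit of the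
      slope, but the coefficient is 0.\<close>
    proof (cases "k < j")
      case True
      then show ?thesis using less that by (intro tendsto_intros slope) auto
    next
      case False
      then show ?thesis using assms(1) less.prems that by (simp add: explicit_rk_def)
    qed
    then have "(Z \<longlongrightarrow> (\<Sum>k=1..rk_s T. rk_A T j k *\<^sub>R (jacobian (G i) (at (u i)) *v ?L u tn i)))
        (at_right 0)"
      unfolding Z_def by (intro tendsto_sum) auto
    then have "((\<lambda>dt. inv_into (B i) (G i) (G i (u i) + dt *\<^sub>R Z dt)) \<longlongrightarrow> u i) (at_right 0)"
      using less.prems B G u by (intro inv_into_perturbation_tendsto) auto
    \<comment> \<open>The stage equations are known for \<open>dt > 0\<close> only, which suffices
      for a limit from the right.\<close>
    moreover have "\<forall>\<^sub>F dt in at_right 0. U dt j i = inv_into (B i) (G i) (G i (u i) + dt *\<^sub>R Z dt)"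
      using U less.prems unfolding rk_stages_def Z_def
      by (auto intro!: eventually_at_rightI[of 0 1])
    ultimately show ?case by (simp cong: tendsto_cong)
  qed
  show "((\<lambda>dt. intermediate_update B G ?L T tn dt u (U dt) i) \<longlongrightarrow> u i) (at_right 0)"
    unfolding intermediate_update_def
  proof (rule inv_into_perturbation_tendsto)
    show "((\<lambda>dt. \<Sum>k=1..rk_s T. rk_b T k *\<^sub>R rk_slope G ?L T tn dt (U dt) k i) \<longlongrightarrow>
        (\<Sum>k=1..rk_s T. rk_b T k *\<^sub>R (jacobian (G i) (at (u i)) *v ?L u tn i))) (at_right 0)"
      by (intro tendsto_intros slope stages \<open>i \<in> V\<close>)
  qed (use \<open>i \<in> V\<close> B G u in auto)
qed

text \<open>Outcomes are not unique, so the limit is taken along an arbitrary selection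
  \<open>v\<close> of one outcome per time step.\<close>

lemma bprk_step_tendsto:
  fixes F :: "real^'m \<Rightarrow> real^'m^'d" and G :: "'v \<Rightarrow> real^'m \<Rightarrow> real^'m"
  assumes "finite V" and m: "\<And>i. i \<in> V \<Longrightarrow> 0 < m i"
    and "explicit_rk T" and "\<And>i. i \<in> V \<Longrightarrow> St i \<subseteq> V"
    and "\<And>i. i \<in> V \<Longrightarrow> isCont F (u i)"
    and "\<And>i. i \<in> V \<Longrightarrow> open (B i)"
    and "\<And>i. i \<in> V \<Longrightarrow> bij_betw (G i) (B i) UNIV \<and> Cinf_on (G i) (B i)"
    and "\<And>i. i \<in> V \<Longrightarrow> u i \<in> B i"
    and v: "\<And>dt. dt > 0 \<Longrightarrow> bprk_step V B G m (semidisc St cc F) T tn dt u (v dt)"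
    and "i \<in> V"
  shows "((\<lambda>dt. v dt i) \<longlongrightarrow> u i) (at_right 0)"
proof -
  let ?ub = "\<lambda>dt. intermediate_update B G (semidisc St cc F) T tn dt u"
  have "\<exists>U. rk_stages V B G (semidisc St cc F) T tn dt u U \<and>
      (\<forall>i\<in>V. dist (v dt i) (?ub dt U i) \<le> norm (mass_defect V m u (?ub dt U)) / m i)"
    if "dt > 0" for dt
    using bprk_step_dist_le[OF v[OF that] \<open>finite V\<close> m] by metis
  \<comment> \<open>The stages must be those that belong to the outcome \<open>v dt\<close>, hence a
    selection in \<open>dt\<close> again.\<close>
  then obtain U where
    U: "\<And>dt. dt > 0 \<Longrightarrow> rk_stages V B G (semidisc St cc F) T tn dt u (U dt)" and
    le: "\<And>dt i. dt > 0 \<Longrightarrow> i \<in> V \<Longrightarrow>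
      dist (v dt i) (?ub dt (U dt) i) \<le> norm (mass_defect V m u (?ub dt (U dt))) / m i"
    by metis
  have ub: "((\<lambda>dt. ?ub dt (U dt) j) \<longlongrightarrow> u j) (at_right 0)" if "j \<in> V" for j
    by (rule intermediate_update_tendsto) (use assms U that in auto)
  \<comment> \<open>The limit is written with \<open>u j - u j\<close> to match the limit rules; it
    is 0.\<close>
  have "((\<lambda>dt. norm (mass_defect V m u (?ub dt (U dt))) / m i) \<longlongrightarrow>
      norm (\<Sum>j\<in>V. m j *\<^sub>R (u j - u j)) / m i) (at_right 0)"
    unfolding mass_defect_def using m[OF \<open>i \<in> V\<close>] by (intro tendsto_intros ub) auto
  then have "((\<lambda>dt. norm (mass_defect V m u (?ub dt (U dt))) / m i) \<longlongrightarrow> 0) (at_right 0)"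
    by simp
  then have "((\<lambda>dt. v dt i - ?ub dt (U dt) i) \<longlongrightarrow> 0) (at_right 0)"
    by (rule Lim_null_comparison[rotated])
       (use le[OF _ \<open>i \<in> V\<close>] in \<open>auto intro!: eventually_at_rightI[of 0 1] simp: dist_norm\<close>)
  from tendsto_add[OF this ub[OF \<open>i \<in> V\<close>]] show ?thesis by simp
qed

section \<open>From the limit along one selection to all outcomes\<close>

theorem theorem3p3:
  fixes V :: "'v set"
    and \<phi> :: "'v \<Rightarrow> real^'d \<Rightarrow> real"
    and P :: "real^'d"
    and F :: "real^'m \<Rightarrow> real^'m^'d"
    and St :: "'v \<Rightarrow> 'v set"
    and cc :: "'v \<Rightarrow> 'v \<Rightarrow> real^'d"
    and m :: "'v \<Rightarrow> real"
    and T :: butcher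
    and B :: "'v \<Rightarrow> (real^'m) set"
    and G :: "'v \<Rightarrow> real^'m \<Rightarrow> real^'m"
  assumes "finite V"
    and "independent_family V \<phi>"
    and "hyperbolic_on (\<Union>i\<in>V. B i) F"
    and "\<And>i. i \<in> V \<Longrightarrow> St i \<subseteq> V"
    and "\<And>i. i \<in> V \<Longrightarrow> 0 < m i"
    and "explicit_rk T"
    and admissible: "\<And>i. i \<in> V \<Longrightarrow> open (B i) \<and> quasiconvex (B i) \<and> B i \<noteq> {}"
    and mapping: "\<And>i. i \<in> V \<Longrightarrow> bij_betw (G i) (B i) UNIV \<and> Cinf_on (G i) (B i)"
    and intermediate: "\<And>tn dt u U i. \<lbrakk>0 < dt; \<forall>j\<in>V. u j \<in> B j;
          rk_stages V B G (semidisc St cc F) T tn dt u U; i \<in> V\<rbrakk>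
          \<Longrightarrow> intermediate_update B G (semidisc St cc F) T tn dt u U i \<in> B i"
    and periodic: "\<And>k. 0 < P $ k" "\<And>i. i \<in> V \<Longrightarrow> on_torus P (\<phi> i)"
    and invariants: "preserves_linear_invariants V B m (semidisc St cc F)"
  shows "bounds_preserving V B (bprk_step V B G m (semidisc St cc F) T)"
  unfolding bounds_preserving_def
proof (intro allI impI)
  fix tn :: real and u :: "'v \<Rightarrow> real^'m"
  assume u: "\<forall>i\<in>V. u i \<in> B i"
  let ?step = "bprk_step V B G m (semidisc St cc F) T tn"
  let ?adm = "\<lambda>v. \<forall>i\<in>V. v i \<in> B i"
  have ex: "\<exists>v. ?step dt u v" for dt
  proof -
    have "\<exists>U. rk_stages V B G (semidisc St cc F) T tn dt u U"
      by (rule explicit_rk_stages_exist) (use assms(4,6) in auto)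
    then show ?thesis using bprk_step_exists by blast
  qed
  \<comment> \<open>Outcomes are not unique: follow an inadmissible one whenever there is one.\<close>
  define v where "v dt = (SOME v. ?step dt u v \<and> (?adm v \<longrightarrow> (\<forall>w. ?step dt u w \<longrightarrow> ?adm w)))" for dt
  \<comment> \<open>An inadmissible outcome satisfies the implication vacuously; if there is none,
    any outcome does.\<close>
  have "\<exists>v. ?step dt u v \<and> (?adm v \<longrightarrow> (\<forall>w. ?step dt u w \<longrightarrow> ?adm w))" for dt
    using ex[of dt] by blast
  from someI_ex[OF this] have v: "?step dt u (v dt)"
    and worst: "?adm (v dt) \<Longrightarrow> ?step dt u w \<Longrightarrow> ?adm w" for dt w
    unfolding v_def by blast+
  have cont: "isCont F (u i)" if "i \<in> V" for i
    using hyperbolic_on_isCont[OF assms(3)] u that by blast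
  have "((\<lambda>dt. v dt i) \<longlongrightarrow> u i) (at_right 0)" if "i \<in> V" for i
    by (rule bprk_step_tendsto[where V = V and St = St and cc = cc and F = F and B = B and G = G
          and m = m and T = T and tn = tn])
       (use assms(1,4-6) cont admissible mapping u v that in auto)
  then have "\<forall>\<^sub>F dt in at_right 0. v dt i \<in> B i" if "i \<in> V" for i
    using that u admissible by (metis topological_tendstoD)
  \<comment> \<open>Finiteness of \<open>V\<close> yields one time step bound for all nodes.\<close>
  then have "\<forall>\<^sub>F dt in at_right 0. ?adm (v dt)"
    using \<open>finite V\<close> by (simp add: eventually_ball_finite)
  then obtain b :: real where b: "0 < b" "\<And>dt. 0 < dt \<Longrightarrow> dt < b \<Longrightarrow> ?adm (v dt)"
    unfolding eventually_at_right_field by auto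
  show "\<exists>\<delta>>0. \<forall>dt. 0 < dt \<and> dt \<le> \<delta> \<longrightarrow>
      (\<exists>v. ?step dt u v) \<and> (\<forall>v. ?step dt u v \<longrightarrow> ?adm v)"
    \<comment> \<open>Halving \<open>b\<close> turns the strict bound \<open>dt < b\<close> into a
      non-strict one.\<close>
    using b ex worst by (intro exI[of _ "b/2"]) (auto, force)
qed

end
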